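(* Let $\mathbf{V}=\{V^n\}_{n=1}^\infty$ and $\mathbf{W}=\{W^n\}_{n=1}^\infty$ be a general source and a general channel, respectively, and for each $n$ let $\varphi_n:\mathcal{V}^n\to\mathcal{X}^n$ be the encoder of a joint source-channel $(n,\varepsilon_n)$ code for $(V^n,W^n)$. Put $X^n=\varphi_n(V^n)$ and let $Y^n$ be the channel output via $W^n$ due to the channel input $X^n$. Let $\gamma>0$ be an arbitrary positive number. Then, for every $n=1,2,\dots$, $$\varepsilon_n \ge \Pr\left\{\frac1n\log\frac{W^n(Y^n|X^n)}{P_{Y^n}(Y^n)} \le \frac1n\log\frac{1}{P_{V^n}(V^n)}-\gamma\right\}-e^{-n\gamma}.$$
   Context: A general source $\mathbf{V}=\{V^n\}_{n=1}^\infty$ is an arbitrary sequence of random variables $V^n=(V_1^{(n)},\dots,V_n^{(n)})$ with values in $\mathcal{V}^n$, where the source alphabet $\mathcal{V}$ is a countably infinite set; no consistency between different $n$ is required. A general channel $\mathbf{W}=\{W^n(\cdot|\cdot):\mathcal{X}^n\to\mathcal{Y}^n\}_{n=1}^\infty$ is an arbitrary sequence of transition probabilities (Markov kernels) $W^n$ from $\mathcal{X}^n$ to $\mathcal{Y}^n$, where $\mathcal{X},\mathcal{Y}$ are arbitrary abstract (measurable) alphabets. $P_Z$ denotes the distribution of $Z$. Logarithms are natural. "$Y^n$ is the channel output via $W^n$ due to the input $X^n$" means that the conditional distribution of $Y^n$ given $X^n=\mathbf{x}$ is $W^n(\cdot|\mathbf{x})$ and $V^n\to X^n\to Y^n$ is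 a Markov chain. For abstract alphabets, $\frac{W^n(Y^n|X^n)}{P_{Y^n}(Y^n)}$ means $g(Y^n|X^n)$, where $g(\mathbf{y}|\mathbf{x})=\frac{W^n(d\mathbf{y}|\mathbf{x})}{P_{Y^n}(d\mathbf{y})}=\frac{P_{X^nY^n}(d\mathbf{x},d\mathbf{y})}{P_{X^n}(d\mathbf{x})P_{Y^n}(d\mathbf{y})}$ is the Radon-Nikodym derivative, measurable in $(\mathbf{x},\mathbf{y})$. A joint source-channel code is a pair of an encoder $\varphi_n:\mathcal{V}^n\to\mathcal{X}^n$ and a decoder $\psi_n:\mathcal{Y}^n\to\mathcal{V}^n$ (deterministic maps). Its probability of decoding error is $\varepsilon_n=\sum_{\mathbf{v}\in\mathcal{V}^n}P_{V^n}(\mathbf{v})\,W^n(\mathcal{D}^c(\mathbf{v})|\varphi_n(\mathbf{v}))$, where $\mathcal{D}(\mathbf{v})=\{\mathbf{y}\in\mathcal{Y}^n:\psi_n(\mathbf{y})=\mathbf{v}\}$. A pair with error probability $\varepsilon_n$ is called a joint source-channel $(n,\varepsilon_n)$ code. *)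

theory Defs
  imports "HOL-Probability.Probability"
begin

(* n-fold product alphabet: blocks indexed by {1..n}, with the product sigma-algebra.
   For a countable A, block n (count_space A) carries the discrete sigma-algebra on A^n. *)
definition block :: "nat \<Rightarrow> 'a measure \<Rightarrow> (nat \<Rightarrow> 'a) measure" where
  "block n S = PiM {1..n} (\<lambda>_. S)"

definition general_source ::
  "'w measure \<Rightarrow> 'v set \<Rightarrow> (nat \<Rightarrow> 'w \<Rightarrow> (nat \<Rightarrow> 'v)) \<Rightarrow> bool" where
  "general_source M A V \<longleftrightarrow>
     prob_space M \<and> countable A \<and> infinite A \<and>
     (\<forall>n\<ge>1. V n \<in> M \<rightarrow>\<^sub>M block n (count_space A))"

(* Only the sigma-algebras of MX and MY matter, not their measures. *)
definition general_channel ::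
  "'x measure \<Rightarrow> 'y measure \<Rightarrow> (nat \<Rightarrow> (nat \<Rightarrow> 'x) \<Rightarrow> (nat \<Rightarrow> 'y) measure) \<Rightarrow> bool" where
  "general_channel MX MY W \<longleftrightarrow>
     (\<forall>n\<ge>1. W n \<in> block n MX \<rightarrow>\<^sub>M prob_algebra (block n MY))"

(* Conditional probability of the event E given the random variable X with values in SX. *)
definition cprob_given :: "'w measure \<Rightarrow> 'a measure \<Rightarrow> ('w \<Rightarrow> 'a) \<Rightarrow> 'w set \<Rightarrow> 'w \<Rightarrow> real" where
  "cprob_given M SX X E = real_cond_exp M (vimage_algebra (space M) X SX) (indicator E)"

definition conditional_distribution ::
  "'w measure \<Rightarrow> 'a measure \<Rightarrow> ('w \<Rightarrow> 'a) \<Rightarrow> 'b measure \<Rightarrow> ('w \<Rightarrow> 'b) \<Rightarrow> ('a \<Rightarrow> 'b measure) \<Rightarrow> bool" where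
  "conditional_distribution M SX X SY Y K \<longleftrightarrow>
     (\<forall>C\<in>sets SY. AE \<omega> in M.
        cprob_given M SX X (Y -` C \<inter> space M) \<omega> = measure (K (X \<omega>)) C)"

(* V \<rightarrow> X \<rightarrow> Y: V and Y are conditionally independent given X. *)
definition markov_chain ::
  "'w measure \<Rightarrow> 'c measure \<Rightarrow> ('w \<Rightarrow> 'c) \<Rightarrow> 'a measure \<Rightarrow> ('w \<Rightarrow> 'a) \<Rightarrow> 'b measure \<Rightarrow> ('w \<Rightarrow> 'b) \<Rightarrow> bool" where
  "markov_chain M SV V SX X SY Y \<longleftrightarrow>
     (\<forall>B\<in>sets SV. \<forall>C\<in>sets SY. AE \<omega> in M.
        cprob_given M SX X ((V -` B \<inter> space M) \<inter> (Y -` C \<inter> space M)) \<omega> =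
        cprob_given M SX X (V -` B \<inter> space M) \<omega> * cprob_given M SX X (Y -` C \<inter> space M) \<omega>)"

definition channel_output ::
  "'w measure \<Rightarrow> 'c measure \<Rightarrow> ('w \<Rightarrow> 'c) \<Rightarrow> 'a measure \<Rightarrow> ('w \<Rightarrow> 'a) \<Rightarrow> 'b measure \<Rightarrow> ('w \<Rightarrow> 'b)
    \<Rightarrow> ('a \<Rightarrow> 'b measure) \<Rightarrow> bool" where
  "channel_output M SV V SX X SY Y K \<longleftrightarrow>
     Y \<in> M \<rightarrow>\<^sub>M SY \<and>
     conditional_distribution M SX X SY Y K \<and>
     markov_chain M SV V SX X SY Y"

definition decoding_error ::
  "'c measure \<Rightarrow> 'b measure \<Rightarrow> ('a \<Rightarrow> 'b measure) \<Rightarrow> ('c \<Rightarrow> 'a) \<Rightarrow> ('b \<Rightarrow> 'c) \<Rightarrow> real" where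
  "decoding_error PV SY K \<phi> \<psi> =
     (\<Sum>\<^sub>\<infinity>v\<in>space PV. measure PV {v} * measure (K (\<phi> v)) (space SY - {y \<in> space SY. \<psi> y = v}))"

(* The pair (\<phi>, \<psi>) is a code with error probability e for a source of law PV. The decoder is
   taken measurable, so that the decoding regions are events. The encoder is an arbitrary map;
   since PV is discrete in the intended use, it is automatically measurable. *)
definition joint_source_channel_code ::
  "'c measure \<Rightarrow> 'a measure \<Rightarrow> 'b measure \<Rightarrow> ('a \<Rightarrow> 'b measure) \<Rightarrow> ('c \<Rightarrow> 'a) \<Rightarrow> ('b \<Rightarrow> 'c) \<Rightarrow> real \<Rightarrow> bool" where
  "joint_source_channel_code PV SX SY K \<phi> \<psi> e \<longleftrightarrow>
     \<phi> \<in> space PV \<rightarrow> space SX \<and> \<psi> \<in> SY \<rightarrow>\<^sub>M PV \<and> e = decoding_error PV SY K \<phi> \<psi>"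

(* g(y|x) = K(dy|x) / P_Y(dy) = P_XY(dx,dy) / (P_X(dx) P_Y(dy)), as the Radon-Nikodym derivative
   of the joint law with respect to the product of the marginals, hence jointly measurable. If X
   takes countably many values (a function of a discrete source), then P_XY is absolutely
   continuous with respect to the product, and g lies in (0,\<infinity>) P_XY-almost surely, so the
   totalisation of enn2real and ln at 0 and \<infinity> only concerns a null event. *)
definition channel_density ::
  "'w measure \<Rightarrow> 'a measure \<Rightarrow> ('w \<Rightarrow> 'a) \<Rightarrow> 'b measure \<Rightarrow> ('w \<Rightarrow> 'b) \<Rightarrow> 'b \<Rightarrow> 'a \<Rightarrow> real" where
  "channel_density M SX X SY Y y x =
     enn2real (RN_deriv (distr M SX X \<Otimes>\<^sub>M distr M SY Y)
                        (distr M (SX \<Otimes>\<^sub>M SY) (\<lambda>\<omega>. (X \<omega>, Y \<omega>))) (x, y))"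

end

theory Submission
  imports Defs
begin

text \<open>
  Decoding can succeed on outputs of low information density only with small probability, so
  that low density mostly means a decoding error. Write \<open>p(v)\<close> for the probability of the block \<open>v\<close>, \<open>D(v)\<close> for its
  decoding region, \<open>P\<^sub>Y\<close> for the output law and \<open>c = n \<gamma>\<close>. Given \<open>V = v\<close> the output has law
  \<open>W(\<phi>(v))\<close>, because the Markov property makes the output depend on the source only through the
  codeword (\<open>joint_law\<close>). Let \<open>L(v)\<close> be the set of outputs \<open>y\<close> for which the density
  \<open>g(y|\<phi>(v)) = dW(\<phi>(v))/dP\<^sub>Y\<close> satisfies \<open>ln g(y|\<phi>(v)) \<le> ln (1/p(v)) - c\<close>, that is
  \<open>g \<le> exp (-c) / p(v)\<close> when \<open>p(v) > 0\<close> and \<open>g\<close> is positive and finite. On \<open>L(v)\<close> the measure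
  \<open>p(v) W(\<phi>(v))\<close> is at most \<open>exp (-c) P\<^sub>Y\<close> (\<open>density_le_imp_kernel_le\<close>).
  The low-density event splits into the part where decoding succeeds and the part where it
  fails. The second part has probability at most that of a decoding
  error. The first part has probability
  \<open>\<Sum>v. p(v) W(\<phi>(v))(L(v) \<inter> D(v)) \<le> exp (-c) (\<Sum>v. P\<^sub>Y(D(v))) \<le> exp (-c)\<close>,
  where the last step holds because the decoding regions are disjoint: one output can be decoded
  correctly for a single \<open>v\<close> only. This is \<open>decoding_error_ge\<close>.

  The measure-theoretic point is that the density is a Radon-Nikodym derivative of the joint law of
  input and output with respect to the product of the marginals, so it is determined only up to a
  null set, and a codeword need not be a measurable singleton of the input space. What
  replaces the atoms of the input law is that a property holding almost surely for the
  input holds at every codeword \<open>\<phi>(v)\<close> with \<open>p(v) > 0\<close> (\<open>AE_PX_imp_at_codeword\<close>), since the event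
  \<open>V = v\<close> has positive probability and the input is constant on it. This yields both the absolute
  continuity of the joint law (\<open>absolutely_continuous_PXY\<close>), without which the derivative would be meaningless,
  and the identification of its section at \<open>\<phi>(v)\<close> as the density of
  \<open>W(\<phi>(v))\<close> with respect to \<open>P\<^sub>Y\<close> (\<open>density_at_codeword\<close>).
\<close>

section \<open>Conditional probabilities and countable sums\<close>

text \<open>
  The only property of conditional probabilities that the argument uses: given \<open>X\<close>, a bounded
  function of \<open>X\<close> behaves as a constant, so it may be moved inside the conditioning before
  averaging.
\<close>

lemma (in prob_space) integral_cprob_given:
  assumes X: "X \<in> M \<rightarrow>\<^sub>M SX" and h: "h \<in> borel_measurable SX"
    and bd: "\<And>x. x \<in> space SX \<Longrightarrow> \<bar>h x\<bar> \<le> b" and E: "E \<in> events"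
  shows "(\<integral>\<omega>. h (X \<omega>) * cprob_given M SX X E \<omega> \<partial>M) = (\<integral>\<omega>. h (X \<omega>) * indicator E \<omega> \<partial>M)"
proof -
  let ?F = "vimage_algebra (space M) X SX"
  have XF: "X \<in> ?F \<rightarrow>\<^sub>M SX"
    by (rule measurable_vimage_algebra1) (use X in \<open>auto simp: measurable_def\<close>)
  have sub: "subalgebra M ?F"
    unfolding subalgebra_def using X by (auto simp: sets_vimage_algebra2 measurable_def)
  interpret F: finite_measure_subalgebra M ?F
    using sub by unfold_locales
  have hF: "(\<lambda>\<omega>. h (X \<omega>)) \<in> borel_measurable ?F"
    using measurable_compose[OF XF h] .
  have [measurable]: "E \<in> events" by (rule E)
  have [measurable]: "(\<lambda>\<omega>. h (X \<omega>)) \<in> borel_measurable M"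
    using measurable_compose[OF X h] .
  have b: "\<bar>h (X \<omega>)\<bar> \<le> b" if "\<omega> \<in> space M" for \<omega>
    using bd measurable_space[OF X that] by auto
  have int: "integrable M (\<lambda>\<omega>. h (X \<omega>) * indicator E \<omega>)"
  proof (rule integrable_const_bound[of _ "\<bar>b\<bar>"])
    show "AE \<omega> in M. norm (h (X \<omega>) * indicator E \<omega>) \<le> \<bar>b\<bar>"
      using b by (intro AE_I2) (force simp: indicator_def)
  qed measurable
  show ?thesis
    unfolding cprob_given_def by (rule F.real_cond_exp_intg(2)[OF int hF]) measurable
qed

lemma (in finite_measure) measure_UN_countable:
  assumes I: "countable I" and X: "\<And>i. i \<in> I \<Longrightarrow> X i \<in> sets M" and disj: "disjoint_family_on X I"
  shows "measure M (\<Union>i\<in>I. X i) = (\<Sum>\<^sub>\<infinity>i\<in>I. measure M (X i))"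
proof -
  have eq: "(\<integral>\<^sup>+i. ennreal (measure M (X i)) \<partial>count_space I) = emeasure M (\<Union>i\<in>I. X i)"
    using emeasure_UN_countable[OF X I disj] by (simp add: emeasure_eq_measure)
  have sum: "Infinite_Set_Sum.abs_summable_on (\<lambda>i. measure M (X i)) I"
    unfolding Infinite_Set_Sum.abs_summable_on_def
    by (rule integrableI_nonneg) (use eq in \<open>auto simp: emeasure_eq_measure\<close>)
  have "emeasure M (\<Union>i\<in>I. X i) = ennreal (\<Sum>\<^sub>\<infinity>i\<in>I. measure M (X i))"
    using nn_integral_conv_infsetsum[OF sum] eq infsetsum_infsum[OF sum] by simp
  then show ?thesis
    by (simp add: emeasure_eq_measure infsum_nonneg)
qed

section \<open>A discrete source sent through a channel\<close>

text \<open>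
  This is the situation at a single block length: source blocks form a countable discrete space
  \<open>S\<close>, so every encoder is measurable, while the input and output spaces are arbitrary.
\<close>

locale encoded_source = prob_space M
  for M :: "'w measure" +
  fixes S :: "'c set" and V :: "'w \<Rightarrow> 'c" and SX :: "'a measure" and \<phi> :: "'c \<Rightarrow> 'a"
    and SY :: "'b measure" and Y :: "'w \<Rightarrow> 'b" and K :: "'a \<Rightarrow> 'b measure"
  assumes countable_S: "countable S"
    and V[measurable]: "V \<in> M \<rightarrow>\<^sub>M count_space S"
    and \<phi>: "\<phi> \<in> S \<rightarrow> space SX"
    and K: "K \<in> SX \<rightarrow>\<^sub>M prob_algebra SY"
    and out: "channel_output M (count_space S) V SX (\<lambda>\<omega>. \<phi> (V \<omega>)) SY Y K"
begin

abbreviation X :: "'w \<Rightarrow> 'a" where "X \<equiv> \<lambda>\<omega>. \<phi> (V \<omega>)"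

abbreviation PX :: "'a measure" where "PX \<equiv> distr M SX X"

abbreviation PY :: "'b measure" where "PY \<equiv> distr M SY Y"

abbreviation PXY :: "('a \<times> 'b) measure" where
  "PXY \<equiv> distr M (SX \<Otimes>\<^sub>M SY) (\<lambda>\<omega>. (X \<omega>, Y \<omega>))"

abbreviation g :: "'a \<times> 'b \<Rightarrow> ennreal" where "g \<equiv> RN_deriv (PX \<Otimes>\<^sub>M PY) PXY"

definition p :: "'c \<Rightarrow> real" where "p v = prob {\<omega> \<in> space M. V \<omega> = v}"

lemma p_nonneg: "p v \<ge> 0"
  unfolding p_def by simp

lemma V_in: "\<omega> \<in> space M \<Longrightarrow> V \<omega> \<in> S"
  using measurable_space[OF V] by simp

lemma X_measurable[measurable]: "X \<in> M \<rightarrow>\<^sub>M SX"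
proof -
  have "\<phi> \<in> count_space S \<rightarrow>\<^sub>M SX" using \<phi> by simp
  from measurable_compose[OF V this] show ?thesis .
qed

lemma Y_measurable[measurable]: "Y \<in> M \<rightarrow>\<^sub>M SY"
  using out unfolding channel_output_def by simp

lemma prob_space_PX: "prob_space PX" and prob_space_PY: "prob_space PY"
  by (auto intro: prob_space_distr)

lemma V_eq_event[measurable]: "{\<omega> \<in> space M. V \<omega> = v} \<in> events"
proof (cases "v \<in> S")
  case True
  then have "V -` {v} \<inter> space M \<in> events" by (intro measurable_sets[OF V]) auto
  then show ?thesis by (simp add: vimage_def Int_def conj_commute)
next
  case False
  then have "{\<omega> \<in> space M. V \<omega> = v} = {}" using V_in by auto
  then show ?thesis by simp
qed

lemma V_Y_event:
  assumes "C \<in> sets SY"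
  shows "{\<omega> \<in> space M. V \<omega> = v \<and> Y \<omega> \<in> C} \<in> events"
proof -
  have "{\<omega> \<in> space M. V \<omega> = v \<and> Y \<omega> \<in> C} = {\<omega> \<in> space M. V \<omega> = v} \<inter> (Y -` C \<inter> space M)"
    by auto
  then show ?thesis using measurable_sets[OF Y_measurable assms] V_eq_event by auto
qed

lemma prob_space_kernel: "x \<in> space SX \<Longrightarrow> prob_space (K x)"
  using measurable_space[OF K] by (auto simp: space_prob_algebra)

lemma kernel_measurable:
  assumes "C \<in> sets SY"
  shows "(\<lambda>x. measure (K x) C) \<in> borel_measurable SX"
    and "(\<lambda>x. emeasure (K x) C) \<in> borel_measurable SX"
  using measurable_compose[OF measurable_prob_algebraD[OF K] measurable_measure_subprob_algebra[OF assms]]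
    measurable_compose[OF measurable_prob_algebraD[OF K] measurable_emeasure_subprob_algebra[OF assms]]
  by auto

lemma kernel_le_1: "x \<in> space SX \<Longrightarrow> \<bar>measure (K x) C\<bar> \<le> 1"
  using prob_space.prob_le_1[OF prob_space_kernel] by (auto simp: abs_if not_less)

text \<open>
  By the Markov property, the conditional probability of \<open>V = v\<close> and \<open>Y \<in> C\<close> given the input is
  the product of that of \<open>V = v\<close> and \<open>K(X)(C)\<close>. The second factor is a function of \<open>X\<close>, so averaging
  turns the first one back into the indicator of \<open>V = v\<close>, on which \<open>K(X)(C)\<close> has the constant value
  \<open>K(\<phi>(v))(C)\<close>.
\<close>

lemma joint_law:
  assumes v: "v \<in> S" and C[measurable]: "C \<in> sets SY"
  shows "prob {\<omega> \<in> space M. V \<omega> = v \<and> Y \<omega> \<in> C} = p v * measure (K (\<phi> v)) C"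
proof -
  let ?E = "V -` {v} \<inter> space M" and ?G = "Y -` C \<inter> space M"
  have E_eq: "?E = {\<omega> \<in> space M. V \<omega> = v}" by auto
  have E: "?E \<in> events" using v by (intro measurable_sets[OF V]) auto
  have G: "?G \<in> events" by (rule measurable_sets[OF Y_measurable C])
  have cond: "AE \<omega> in M. cprob_given M SX X ?G \<omega> = measure (K (X \<omega>)) C"
    using out C unfolding channel_output_def conditional_distribution_def by blast
  have markov: "AE \<omega> in M. cprob_given M SX X (?E \<inter> ?G) \<omega> =
      cprob_given M SX X ?E \<omega> * cprob_given M SX X ?G \<omega>"
    using out C v unfolding channel_output_def markov_chain_def by simp
  have [measurable]: "cprob_given M SX X H \<in> borel_measurable M" for H
    unfolding cprob_given_def by simp
  have [measurable]: "(\<lambda>\<omega>. measure (K (X \<omega>)) C) \<in> borel_measurable M"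
    using measurable_compose[OF X_measurable kernel_measurable(1)[OF C]] .
  have "prob (?E \<inter> ?G) = (\<integral>\<omega>. 1 * indicator (?E \<inter> ?G) \<omega> \<partial>M)"
    by (simp add: Int_absorb2 le_infI1)
  also have "\<dots> = (\<integral>\<omega>. 1 * cprob_given M SX X (?E \<inter> ?G) \<omega> \<partial>M)"
    using E G by (intro integral_cprob_given[symmetric, where h="\<lambda>_. 1" and b=1]) auto
  also have "\<dots> = (\<integral>\<omega>. measure (K (X \<omega>)) C * cprob_given M SX X ?E \<omega> \<partial>M)"
    by (rule integral_cong_AE) (use cond markov in \<open>auto\<close>)
  also have "\<dots> = (\<integral>\<omega>. measure (K (X \<omega>)) C * indicator ?E \<omega> \<partial>M)"
    by (rule integral_cprob_given[where b=1, OF X_measurable kernel_measurable(1)[OF C] _ E])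
      (rule kernel_le_1)
  also have "\<dots> = (\<integral>\<omega>. measure (K (\<phi> v)) C * indicator ?E \<omega> \<partial>M)"
    by (rule Bochner_Integration.integral_cong) (auto simp: indicator_def)
  also have "\<dots> = p v * measure (K (\<phi> v)) C"
    unfolding p_def by (simp add: E_eq)
  also have "?E \<inter> ?G = {\<omega> \<in> space M. V \<omega> = v \<and> Y \<omega> \<in> C}" by auto
  finally show ?thesis .
qed

lemma emeasure_joint_law:
  assumes v: "v \<in> S" and C: "C \<in> sets SY"
  shows "emeasure M {\<omega> \<in> space M. V \<omega> = v \<and> Y \<omega> \<in> C} = ennreal (p v) * emeasure (K (\<phi> v)) C"
proof -
  interpret Kv: prob_space "K (\<phi> v)" using prob_space_kernel \<phi> v by auto
  show ?thesis
    by (simp add: emeasure_eq_measure Kv.emeasure_eq_measure joint_law[OF v C] ennreal_mult p_nonneg)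
qed

lemma input_output_law:
  assumes B[measurable]: "B \<in> sets SX" and C[measurable]: "C \<in> sets SY"
  shows "emeasure PXY (B \<times> C) = (\<integral>\<^sup>+x. emeasure (K x) C * indicator B x \<partial>PX)"
proof -
  let ?G = "Y -` C \<inter> space M"
  have G: "?G \<in> events" by (rule measurable_sets[OF Y_measurable C])
  have cond: "AE \<omega> in M. cprob_given M SX X ?G \<omega> = measure (K (X \<omega>)) C"
    using out C unfolding channel_output_def conditional_distribution_def by blast
  have [measurable]: "cprob_given M SX X H \<in> borel_measurable M" for H
    unfolding cprob_given_def by simp
  have [measurable]: "(\<lambda>x. measure (K x) C) \<in> borel_measurable SX"
    "(\<lambda>x. emeasure (K x) C) \<in> borel_measurable SX"
    using kernel_measurable[OF C] .
  have le1: "measure (K (X \<omega>)) C \<le> 1" if "\<omega> \<in> space M" for \<omega>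
    using kernel_le_1 measurable_space[OF X_measurable that] by auto
  have "prob ((\<lambda>\<omega>. (X \<omega>, Y \<omega>)) -` (B \<times> C) \<inter> space M) =
      (\<integral>\<omega>. indicator ((\<lambda>\<omega>. (X \<omega>, Y \<omega>)) -` (B \<times> C) \<inter> space M) \<omega> \<partial>M)"
    by simp
  also have "\<dots> = (\<integral>\<omega>. indicator B (X \<omega>) * indicator ?G \<omega> \<partial>M)"
    by (rule Bochner_Integration.integral_cong) (auto simp: indicator_def)
  also have "\<dots> = (\<integral>\<omega>. indicator B (X \<omega>) * cprob_given M SX X ?G \<omega> \<partial>M)"
    by (rule integral_cprob_given[symmetric, where b=1, OF X_measurable _ _ G]) (auto simp: indicator_def)
  also have "\<dots> = (\<integral>\<omega>. indicator B (X \<omega>) * measure (K (X \<omega>)) C \<partial>M)"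
    by (rule integral_cong_AE) (use cond in auto)
  finally have *: "prob ((\<lambda>\<omega>. (X \<omega>, Y \<omega>)) -` (B \<times> C) \<inter> space M) = \<dots>" .
  have "emeasure PXY (B \<times> C) = emeasure M ((\<lambda>\<omega>. (X \<omega>, Y \<omega>)) -` (B \<times> C) \<inter> space M)"
    by (rule emeasure_distr) auto
  also have "\<dots> = ennreal (\<integral>\<omega>. indicator B (X \<omega>) * measure (K (X \<omega>)) C \<partial>M)"
    unfolding emeasure_eq_measure * ..
  also have "\<dots> = (\<integral>\<^sup>+\<omega>. ennreal (indicator B (X \<omega>) * measure (K (X \<omega>)) C) \<partial>M)"
    by (rule nn_integral_eq_integral[symmetric])
      (auto intro!: integrable_const_bound[of _ 1] simp: indicator_def le1)
  also have "\<dots> = (\<integral>\<^sup>+\<omega>. emeasure (K (X \<omega>)) C * indicator B (X \<omega>) \<partial>M)"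
  proof (rule nn_integral_cong)
    fix \<omega> assume "\<omega> \<in> space M"
    then interpret Kx: prob_space "K (X \<omega>)"
      using prob_space_kernel measurable_space[OF X_measurable] by auto
    show "ennreal (indicator B (X \<omega>) * measure (K (X \<omega>)) C) = emeasure (K (X \<omega>)) C * indicator B (X \<omega>)"
      by (simp add: Kx.emeasure_eq_measure indicator_def)
  qed
  also have "\<dots> = (\<integral>\<^sup>+x. emeasure (K x) C * indicator B x \<partial>PX)"
    by (subst nn_integral_distr) auto
  finally show ?thesis .
qed

lemma kernel_le_output:
  assumes v: "v \<in> S" and C: "C \<in> sets SY"
  shows "ennreal (p v) * emeasure (K (\<phi> v)) C \<le> emeasure PY C"
  unfolding emeasure_joint_law[OF v C, symmetric]
  by (subst emeasure_distr[OF Y_measurable C], rule emeasure_mono)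
    (auto intro: measurable_sets[OF Y_measurable C])

text \<open>
  A codeword of positive probability acts as an atom of the input law, although \<open>{\<phi> v}\<close> may fail to
  be measurable: if \<open>Q\<close> failed at \<open>\<phi> v\<close>, it would fail throughout the event \<open>V = v\<close>, which would
  then be null.
\<close>

lemma AE_PX_imp_at_codeword:
  assumes "AE x in PX. Q x" and "p v > 0"
  shows "Q (\<phi> v)"
proof (rule ccontr)
  assume "\<not> Q (\<phi> v)"
  moreover have "AE \<omega> in M. Q (X \<omega>)" by (rule AE_distrD[OF X_measurable assms(1)])
  ultimately have "AE \<omega> in M. V \<omega> \<noteq> v" by (auto elim!: eventually_mono)
  then have "p v = 0"
    unfolding p_def by (auto intro!: prob_eq_0_AE)
  then show False using assms(2) by simp
qed

text \<open>
  If \<open>N\<close> is null for the product, then almost every section of \<open>N\<close> is null for the output law,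
  and so is the section at every codeword of positive probability. Each kernel \<open>K(\<phi>(v))\<close>
  is dominated by a multiple of the output law, so it also gives that section measure zero; and
  countably many \<open>v\<close> exhaust the joint law.
\<close>

lemma absolutely_continuous_PXY: "absolutely_continuous (PX \<Otimes>\<^sub>M PY) PXY"
  unfolding absolutely_continuous_def
proof
  fix N assume N: "N \<in> null_sets (PX \<Otimes>\<^sub>M PY)"
  interpret PY: prob_space PY by (rule prob_space_PY)
  interpret PX: prob_space PX by (rule prob_space_PX)
  interpret pair_sigma_finite PX PY ..
  have "sets (PX \<Otimes>\<^sub>M PY) = sets (SX \<Otimes>\<^sub>M SY)" by (intro sets_pair_measure_cong) auto
  then have N'[measurable]: "N \<in> sets (SX \<Otimes>\<^sub>M SY)" using N by auto
  have slice: "Pair x -` N \<in> sets SY" for x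
    by (rule sets_Pair1[OF N'])
  have sections: "AE x in PX. emeasure PY (Pair x -` N) = 0"
  proof -
    have "AE x in PX. AE y in PY. (x, y) \<notin> N" by (rule AE_pair[OF AE_not_in[OF N]])
    then show ?thesis
    proof (rule eventually_mono)
      fix x assume "AE y in PY. (x, y) \<notin> N"
      then have "AE y in PY. y \<notin> Pair x -` N" by simp
      then show "emeasure PY (Pair x -` N) = 0"
        using slice[of x] by (simp add: AE_iff_null_sets null_setsD1)
    qed
  qed
  have "AE \<omega> in M. \<not> (V \<omega> = v \<and> Y \<omega> \<in> Pair (\<phi> v) -` N)" if v: "v \<in> S" for v
  proof -
    have "ennreal (p v) * emeasure (K (\<phi> v)) (Pair (\<phi> v) -` N) = 0"
    proof (cases "p v > 0")
      case True
      then show ?thesis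
        using AE_PX_imp_at_codeword[OF sections True] kernel_le_output[OF v slice[of "\<phi> v"]] by simp
    next
      case False
      then show ?thesis using p_nonneg[of v] by simp
    qed
    then have "{\<omega> \<in> space M. V \<omega> = v \<and> Y \<omega> \<in> Pair (\<phi> v) -` N} \<in> null_sets M"
      using emeasure_joint_law[OF v slice] V_Y_event[OF slice] by (auto intro!: null_setsI)
    from AE_not_in[OF this] show ?thesis by (auto elim!: eventually_mono)
  qed
  then have "AE \<omega> in M. \<forall>v\<in>S. \<not> (V \<omega> = v \<and> Y \<omega> \<in> Pair (\<phi> v) -` N)"
    by (intro AE_ball_countable'[OF _ countable_S])
  then have "AE \<omega> in M. (X \<omega>, Y \<omega>) \<notin> N"
    using AE_space by eventually_elim (use V_in in auto)
  then have "AE z in PXY. z \<notin> N"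
    by (subst AE_distr_iff) auto
  then show "N \<in> null_sets PXY"
    using N' by (subst (asm) AE_iff_null_sets[symmetric]) auto
qed

lemma g_measurable[measurable]: "g \<in> borel_measurable (SX \<Otimes>\<^sub>M SY)"
proof -
  have "sets (PX \<Otimes>\<^sub>M PY) = sets (SX \<Otimes>\<^sub>M SY)" by (intro sets_pair_measure_cong) auto
  from measurable_cong_sets[OF this refl] show ?thesis using borel_measurable_RN_deriv by blast
qed

text \<open>
  For a fixed \<open>C\<close>, the functions \<open>x \<mapsto> \<integral>\<^sub>C g(x,y) dP\<^sub>Y\<close> and \<open>x \<mapsto> K(x)(C)\<close> have the same integral over every
  input event, because both integrals are the joint probability of a rectangle. Hence they agree
  for almost every input, with an exceptional set that depends on \<open>C\<close>. The codewords of
  positive probability avoid all these sets, so the conclusion is available for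
  every \<open>C\<close> even when the output \<sigma>-algebra is not countably generated.
\<close>

lemma density_at_codeword:
  assumes v: "v \<in> S" "p v > 0" and C[measurable]: "C \<in> sets SY"
  shows "(\<integral>\<^sup>+y. g (\<phi> v, y) * indicator C y \<partial>PY) = emeasure (K (\<phi> v)) C"
proof -
  interpret PY: prob_space PY by (rule prob_space_PY)
  interpret PX: prob_space PX by (rule prob_space_PX)
  interpret pair_sigma_finite PX PY ..
  have sets: "sets (PX \<Otimes>\<^sub>M PY) = sets (SX \<Otimes>\<^sub>M SY)" by (intro sets_pair_measure_cong) auto
  have [measurable]: "(\<lambda>x. emeasure (K x) C) \<in> borel_measurable SX"
    using kernel_measurable(2)[OF C] .
  have "(\<integral>\<^sup>+x. (\<integral>\<^sup>+y. g (x, y) * indicator C y \<partial>PY) * indicator B x \<partial>PX) =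
      (\<integral>\<^sup>+x. emeasure (K x) C * indicator B x \<partial>PX)" if "B \<in> sets PX" for B
  proof -
    have B[measurable]: "B \<in> sets SX" using that by simp
    have "(\<integral>\<^sup>+x. (\<integral>\<^sup>+y. g (x, y) * indicator C y \<partial>PY) * indicator B x \<partial>PX) =
        (\<integral>\<^sup>+x. \<integral>\<^sup>+y. g (x, y) * indicator (B \<times> C) (x, y) \<partial>PY \<partial>PX)"
      by (rule nn_integral_cong) (auto simp: indicator_def)
    also have "\<dots> = (\<integral>\<^sup>+z. g z * indicator (B \<times> C) z \<partial>(PX \<Otimes>\<^sub>M PY))"
      by (rule PY.nn_integral_fst) measurable
    also have "\<dots> = emeasure (density (PX \<Otimes>\<^sub>M PY) g) (B \<times> C)"
      by (rule emeasure_density[symmetric]) auto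
    also have "\<dots> = emeasure PXY (B \<times> C)"
      using density_RN_deriv[OF absolutely_continuous_PXY] sets by simp
    also have "\<dots> = (\<integral>\<^sup>+x. emeasure (K x) C * indicator B x \<partial>PX)"
      by (rule input_output_law) measurable
    finally show ?thesis .
  qed
  then have "AE x in PX. (\<integral>\<^sup>+y. g (x, y) * indicator C y \<partial>PY) = emeasure (K x) C"
    by (intro PX.density_unique2) auto
  from AE_PX_imp_at_codeword[OF this v(2)] show ?thesis .
qed

text \<open>
  Integrating the pointwise bound \<open>g \<le> exp (-c) / p v\<close> over \<open>C\<close>. The logarithm controls \<open>g\<close> only where
  \<open>g\<close> is positive and finite: where \<open>g = 0\<close> the bound is trivial, and \<open>g = \<infinity>\<close> happens on a null set
  because \<open>g(\<phi>(v), \<cdot>)\<close> integrates to 1.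
\<close>

lemma density_le_imp_kernel_le:
  assumes v: "v \<in> S" and C[measurable]: "C \<in> sets SY"
    and le: "\<And>y. y \<in> C \<Longrightarrow> ln (enn2real (g (\<phi> v, y))) \<le> ln (1 / p v) - c"
  shows "ennreal (p v) * emeasure (K (\<phi> v)) C \<le> ennreal (exp (- c)) * emeasure PY C"
proof (cases "p v > 0")
  case True
  interpret PY: prob_space PY by (rule prob_space_PY)
  interpret Kv: prob_space "K (\<phi> v)" using prob_space_kernel \<phi> v by auto
  have x[simp]: "\<phi> v \<in> space SX" using \<phi> v by auto
  have [measurable]: "(\<lambda>y. g (\<phi> v, y)) \<in> borel_measurable SY"
    by (rule measurable_compose[OF measurable_Pair1' g_measurable]) simp
  have "(\<integral>\<^sup>+y. g (\<phi> v, y) \<partial>PY) = (\<integral>\<^sup>+y. g (\<phi> v, y) * indicator (space SY) y \<partial>PY)"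
    by (rule nn_integral_cong) simp
  also have "\<dots> = emeasure (K (\<phi> v)) (space SY)"
    by (rule density_at_codeword[OF v True]) simp
  finally have "(\<integral>\<^sup>+y. g (\<phi> v, y) \<partial>PY) \<noteq> \<infinity>"
    by (simp add: Kv.emeasure_eq_measure)
  then have fin: "AE y in PY. g (\<phi> v, y) \<noteq> \<infinity>"
    by (intro nn_integral_noteq_infinite) auto
  have "emeasure (K (\<phi> v)) C = (\<integral>\<^sup>+y. g (\<phi> v, y) * indicator C y \<partial>PY)"
    by (rule density_at_codeword[OF v True C, symmetric])
  also have "\<dots> \<le> (\<integral>\<^sup>+y. ennreal (exp (- c) / p v) * indicator C y \<partial>PY)"
  proof (rule nn_integral_mono_AE)
    show "AE y in PY. g (\<phi> v, y) * indicator C y \<le> ennreal (exp (- c) / p v) * indicator C y"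
      using fin
    proof eventually_elim
      case (elim y)
      define r where "r = enn2real (g (\<phi> v, y))"
      have g: "g (\<phi> v, y) = ennreal r" using elim by (simp add: r_def less_top)
      have "r \<le> exp (- c) / p v" if "y \<in> C"
      proof (cases "r > 0")
        case pos: True
        have "r = exp (ln r)" using pos by simp
        also have "\<dots> \<le> exp (ln (1 / p v) - c)" using le[OF that] by (simp add: r_def)
        also have "\<dots> = exp (- c) / p v" using True by (simp add: exp_diff exp_minus field_simps)
        finally show ?thesis .
      next
        case False
        moreover have "0 \<le> exp (- c) / p v" using True by simp
        ultimately show ?thesis by linarith
      qed
      then show ?case by (auto simp: g indicator_def intro: ennreal_leI)
    qed
  qed
  also have "\<dots> = ennreal (exp (- c) / p v) * emeasure PY C"
    by (rule nn_integral_cmult_indicator) simp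
  finally have "ennreal (p v) * emeasure (K (\<phi> v)) C \<le>
      ennreal (p v) * (ennreal (exp (- c) / p v) * emeasure PY C)"
    by (rule mult_left_mono) simp
  also have "\<dots> = ennreal (exp (- c)) * emeasure PY C"
    using True by (simp add: mult.assoc[symmetric] ennreal_mult[symmetric])
  finally show ?thesis .
next
  case False
  then show ?thesis using p_nonneg[of v] by simp
qed

section \<open>Splitting by correctness of decoding\<close>

text \<open>
  Disintegration over the value of the source. With \<open>F(v)\<close> the complement of a decoding region, the
  last formula is the probability of a decoding error.
\<close>

lemma event_by_source:
  assumes F: "\<And>v. v \<in> S \<Longrightarrow> F v \<in> sets SY"
  shows "{\<omega> \<in> space M. Y \<omega> \<in> F (V \<omega>)} \<in> events"
    and "emeasure M {\<omega> \<in> space M. Y \<omega> \<in> F (V \<omega>)} =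
      (\<integral>\<^sup>+v. ennreal (p v) * emeasure (K (\<phi> v)) (F v) \<partial>count_space S)"
    and "prob {\<omega> \<in> space M. Y \<omega> \<in> F (V \<omega>)} = (\<Sum>\<^sub>\<infinity>v\<in>S. p v * measure (K (\<phi> v)) (F v))"
proof -
  define E where "E v = {\<omega> \<in> space M. V \<omega> = v \<and> Y \<omega> \<in> F v}" for v
  have un: "{\<omega> \<in> space M. Y \<omega> \<in> F (V \<omega>)} = (\<Union>v\<in>S. E v)"
    using V_in by (auto simp: E_def)
  have E: "E v \<in> events" if "v \<in> S" for v
    unfolding E_def by (rule V_Y_event[OF F[OF that]])
  have disj: "disjoint_family_on E S"
    by (auto simp: disjoint_family_on_def E_def)
  show "{\<omega> \<in> space M. Y \<omega> \<in> F (V \<omega>)} \<in> events"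
    unfolding un by (rule sets.countable_UN'[OF countable_S]) (auto intro: E)
  show "emeasure M {\<omega> \<in> space M. Y \<omega> \<in> F (V \<omega>)} =
      (\<integral>\<^sup>+v. ennreal (p v) * emeasure (K (\<phi> v)) (F v) \<partial>count_space S)"
    unfolding un
    by (subst emeasure_UN_countable[OF _ countable_S disj])
      (auto intro!: nn_integral_cong simp: E_def V_Y_event emeasure_joint_law F)
  show "prob {\<omega> \<in> space M. Y \<omega> \<in> F (V \<omega>)} = (\<Sum>\<^sub>\<infinity>v\<in>S. p v * measure (K (\<phi> v)) (F v))"
    unfolding un
    by (subst measure_UN_countable[OF countable_S _ disj])
      (auto intro!: infsum_cong simp: E_def V_Y_event joint_law F)
qed

lemma decoding_error_ge:
  assumes \<psi>: "\<psi> \<in> SY \<rightarrow>\<^sub>M count_space S"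
  shows "prob {\<omega> \<in> space M. ln (channel_density M SX X SY Y (Y \<omega>) (X \<omega>)) \<le> ln (1 / p (V \<omega>)) - c}
    - exp (- c) \<le> (\<Sum>\<^sub>\<infinity>v\<in>S. p v * measure (K (\<phi> v)) (space SY - {y \<in> space SY. \<psi> y = v}))"
proof -
  define D where "D v = {y \<in> space SY. \<psi> y = v}" for v
  define L where "L v = {y \<in> space SY. ln (enn2real (g (\<phi> v, y))) \<le> ln (1 / p v) - c}" for v
  have D: "D v \<in> sets SY" if "v \<in> S" for v
  proof -
    have "D v = \<psi> -` {v} \<inter> space SY" by (auto simp: D_def)
    then show ?thesis using measurable_sets[OF \<psi>, of "{v}"] that by simp
  qed
  have L: "L v \<in> sets SY" if "v \<in> S" for v
  proof -
    have [measurable]: "(\<lambda>y. g (\<phi> v, y)) \<in> borel_measurable SY"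
      by (rule measurable_compose[OF measurable_Pair1' g_measurable]) (use \<phi> that in auto)
    show ?thesis unfolding L_def by measurable
  qed
  let ?low = "{\<omega> \<in> space M. Y \<omega> \<in> L (V \<omega>)}"
  let ?low_correct = "{\<omega> \<in> space M. Y \<omega> \<in> L (V \<omega>) \<inter> D (V \<omega>)}"
  let ?wrong = "{\<omega> \<in> space M. Y \<omega> \<in> space SY - D (V \<omega>)}"
  have low: "{\<omega> \<in> space M. ln (channel_density M SX X SY Y (Y \<omega>) (X \<omega>)) \<le> ln (1 / p (V \<omega>)) - c} = ?low"
    using measurable_space[OF Y_measurable] by (auto simp: L_def channel_density_def)
  \<comment> \<open>The domination on \<open>L v \<inter> D v\<close> cancels the factor \<open>p v\<close>, leaving a total of output probabilities of
    disjoint sets.\<close>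
  have "emeasure M ?low_correct = (\<integral>\<^sup>+v. ennreal (p v) * emeasure (K (\<phi> v)) (L v \<inter> D v) \<partial>count_space S)"
    by (rule event_by_source(2)) (use L D in auto)
  also have "\<dots> \<le> (\<integral>\<^sup>+v. ennreal (exp (- c)) * emeasure PY (D v) \<partial>count_space S)"
  proof (rule nn_integral_mono)
    fix v assume "v \<in> space (count_space S)"
    then have v: "v \<in> S" by simp
    have "ennreal (p v) * emeasure (K (\<phi> v)) (L v \<inter> D v) \<le> ennreal (exp (- c)) * emeasure PY (L v \<inter> D v)"
      by (rule density_le_imp_kernel_le[OF v]) (use L[OF v] D[OF v] in \<open>auto simp: L_def\<close>)
    also have "\<dots> \<le> ennreal (exp (- c)) * emeasure PY (D v)"
      using D[OF v] by (intro mult_left_mono emeasure_mono) auto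
    finally show "ennreal (p v) * emeasure (K (\<phi> v)) (L v \<inter> D v) \<le> \<dots>" .
  qed
  also have "\<dots> = ennreal (exp (- c)) * (\<integral>\<^sup>+v. emeasure PY (D v) \<partial>count_space S)"
    by (rule nn_integral_cmult) simp
  also have "(\<integral>\<^sup>+v. emeasure PY (D v) \<partial>count_space S) = emeasure PY (\<Union>v\<in>S. D v)"
    by (rule emeasure_UN_countable[symmetric])
      (use D countable_S in \<open>auto simp: disjoint_family_on_def D_def\<close>)
  also have "ennreal (exp (- c)) * emeasure PY (\<Union>v\<in>S. D v) \<le> ennreal (exp (- c)) * 1"
    by (intro mult_left_mono prob_space.measure_le_1[OF prob_space_PY]) auto
  finally have correct: "prob ?low_correct \<le> exp (- c)"
    by (simp add: emeasure_eq_measure)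
  have "prob ?low \<le> prob (?low_correct \<union> ?wrong)"
    by (rule finite_measure_mono)
      (use measurable_space[OF Y_measurable] event_by_source(1)[of "\<lambda>v. L v \<inter> D v"]
        event_by_source(1)[of "\<lambda>v. space SY - D v"] L D in auto)
  also have "\<dots> \<le> prob ?low_correct + prob ?wrong"
    by (rule measure_Un_le) (rule event_by_source(1); use L D in auto)+
  also have "prob ?wrong = (\<Sum>\<^sub>\<infinity>v\<in>S. p v * measure (K (\<phi> v)) (space SY - D v))"
    by (rule event_by_source(3)) (use D in auto)
  finally show ?thesis
    using correct unfolding low D_def by linarith
qed

end

section \<open>The error bound for block codes\<close>

lemma block_count_space:
  "countable A \<Longrightarrow> block n (count_space A) = count_space ({1..n} \<rightarrow>\<^sub>E A)"
  unfolding block_def by (rule count_space_PiM_finite) auto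

theorem lemma3p2:
  fixes M :: "'w measure" and A :: "'v set" and MX :: "'x measure" and MY :: "'y measure"
    and V :: "nat \<Rightarrow> 'w \<Rightarrow> (nat \<Rightarrow> 'v)"
    and X :: "nat \<Rightarrow> 'w \<Rightarrow> (nat \<Rightarrow> 'x)"
    and Y :: "nat \<Rightarrow> 'w \<Rightarrow> (nat \<Rightarrow> 'y)"
    and PV :: "nat \<Rightarrow> (nat \<Rightarrow> 'v) measure"
    and W :: "nat \<Rightarrow> (nat \<Rightarrow> 'x) \<Rightarrow> (nat \<Rightarrow> 'y) measure"
    and \<phi> :: "nat \<Rightarrow> (nat \<Rightarrow> 'v) \<Rightarrow> (nat \<Rightarrow> 'x)"
    and \<psi> :: "nat \<Rightarrow> (nat \<Rightarrow> 'y) \<Rightarrow> (nat \<Rightarrow> 'v)"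
    and \<epsilon> :: "nat \<Rightarrow> real" and \<gamma> :: real
  assumes source: "general_source M A V"
    and PV: "PV = (\<lambda>n. distr M (block n (count_space A)) (V n))"
    and channel: "general_channel MX MY W"
    and code: "\<And>n. n \<ge> 1 \<Longrightarrow>
      joint_source_channel_code (PV n) (block n MX) (block n MY) (W n) (\<phi> n) (\<psi> n) (\<epsilon> n)"
    and input: "X = (\<lambda>n \<omega>. \<phi> n (V n \<omega>))"
    and channel_out: "\<And>n. n \<ge> 1 \<Longrightarrow>
      channel_output M (block n (count_space A)) (V n) (block n MX) (X n) (block n MY) (Y n) (W n)"
    and gamma: "\<gamma> > 0"
  shows "\<forall>n\<ge>1. \<epsilon> n \<ge>
    \<P>(\<omega> in M. 1 / real n * ln (channel_density M (block n MX) (X n) (block n MY) (Y n) (Y n \<omega>) (X n \<omega>))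
             \<le> 1 / real n * ln (1 / measure (PV n) {V n \<omega>}) - \<gamma>)
    - exp (- real n * \<gamma>)"
proof (intro allI impI)
  fix n :: nat assume n: "n \<ge> 1"
  let ?S = "{1..n} \<rightarrow>\<^sub>E A"
  from source have M: "prob_space M" and A: "countable A"
    and V: "V n \<in> M \<rightarrow>\<^sub>M block n (count_space A)"
    using n by (auto simp: general_source_def)
  note blk = block_count_space[OF A]
  have PVn: "PV n = distr M (count_space ?S) (V n)" by (simp add: PV blk)
  have code': "\<phi> n \<in> ?S \<rightarrow> space (block n MX)" "\<psi> n \<in> block n MY \<rightarrow>\<^sub>M count_space ?S"
    "\<epsilon> n = decoding_error (PV n) (block n MY) (W n) (\<phi> n) (\<psi> n)"
    using code[OF n] by (auto simp: joint_source_channel_code_def PVn)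
  have "encoded_source M ?S (V n) (block n MX) (\<phi> n) (block n MY) (Y n) (W n)"
    unfolding encoded_source_def encoded_source_axioms_def
    using M V channel channel_out[OF n] code'(1) n A
    by (auto simp: blk input general_channel_def intro!: countable_PiE)
  then interpret encoded_source M ?S "V n" "block n MX" "\<phi> n" "block n MY" "Y n" "W n" .
  have p: "measure (PV n) {v} = p v" if "v \<in> ?S" for v
    using that V
    by (simp add: PVn blk measure_distr p_def vimage_def Int_def conj_commute)
  have space_PV: "space (PV n) = ?S" by (simp add: PVn)
  have err: "\<epsilon> n = (\<Sum>\<^sub>\<infinity>v\<in>?S. p v * measure (W n (\<phi> n v))
      (space (block n MY) - {y \<in> space (block n MY). \<psi> n y = v}))"
    unfolding code'(3) decoding_error_def space_PV by (rule infsum_cong) (simp only: p)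
  have scale: "1 / real n * a \<le> 1 / real n * b - \<gamma> \<longleftrightarrow> a \<le> b - real n * \<gamma>" for a b :: real
    using n by (simp add: field_simps)
  have "{\<omega> \<in> space M. 1 / real n * ln (channel_density M (block n MX) (X n) (block n MY) (Y n) (Y n \<omega>) (X n \<omega>))
      \<le> 1 / real n * ln (1 / measure (PV n) {V n \<omega>}) - \<gamma>} =
    {\<omega> \<in> space M. ln (channel_density M (block n MX) (\<lambda>\<omega>. \<phi> n (V n \<omega>)) (block n MY) (Y n) (Y n \<omega>) (\<phi> n (V n \<omega>)))
      \<le> ln (1 / p (V n \<omega>)) - real n * \<gamma>}"
    unfolding scale input using V_in p by auto
  then show "\<epsilon> n \<ge> \<P>(\<omega> in M.
      1 / real n * ln (channel_density M (block n MX) (X n) (block n MY) (Y n) (Y n \<omega>) (X n \<omega>))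
        \<le> 1 / real n * ln (1 / measure (PV n) {V n \<omega>}) - \<gamma>) - exp (- real n * \<gamma>)"
    using decoding_error_ge[OF code'(2), of "real n * \<gamma>"] unfolding err by simp
qed

end
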